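(* Assume that $(\mathbb{X},\mathcal{X})$ has a measurable diagonal. Let $\eta$ be a Gibbs process with PI $\kappa$ (and reference measure $\lambda$), and fix $m\in\mathbb{N}$. Then, for any permutation $\tau$ of $\{1,\dots,m\}$, $$\kappa_m(x_1,\dots,x_m,\mu)=\kappa_m\big(x_{\tau(1)},\dots,x_{\tau(m)},\mu\big)$$ for $(\lambda^m\otimes\mathbb{P}^\eta)$-a.e. $(x_1,\dots,x_m,\mu)\in\mathbb{X}^m\times\mathbf{N}$, where $\mathbb{P}^\eta$ is the distribution of $\eta$.
   Context: Setting. $(\mathbb{X},\mathcal{X})$ is a measurable space which is localized: there are fixed sets $B_1\subset B_2\subset\dots$ in $\mathcal{X}$ with $\bigcup_j B_j=\mathbb{X}$. $\mathcal{X}_b$ is the collection of all sets in $\mathcal{X}$ contained in some $B_j$. $\mathbf{N}$ is the set of all measures $\mu$ on $\mathbb{X}$ with $\mu(B)\in\{0,1,2,\dots\}$ for each $B\in\mathcal{X}_b$, with the $\sigma$-field $\mathcal{N}$ generated by the maps $\mu\mapsto\mu(B)$, $B\in\mathcal{X}$. A point process in $\mathbb{X}$ is a random element of $\mathbf{N}$ on some probability space. $\delta_x$ is the Dirac measure in $x$. $\lambda$ is a fixed locally finite measure on $\mathbb{X}$ ($\lambda(B)<\infty$ for $B\in\mathcal{X}_b$). The space has a measurable diagonal if $\{(x,x):x\in\mathbb{X}\}\in\mathcal{X}^{\otimes2}$. $\kappa:\mathbb{X}\times\mathbf{N}\to[0,\infty)$ is measurable (no cocycle relation is assumed here), and $$\kappa_m(x_1,\dots,x_m,\mu)=\kappa(x_m,\mu)\,\kappa(x_{m-1},\mu+\delta_{x_m})\cdots\kappa(x_1,\mu+\delta_{x_2}+\dots+\delta_{x_m}).$$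 Gibbs process. A point process $\eta$ is a Gibbs process with Papangelou intensity (PI) $\kappa$ and reference measure $\lambda$ if $\mathbb{E}[\int_{\mathbb{X}}f(x,\eta)\,\mathrm{d}\eta(x)]=\mathbb{E}[\int_{\mathbb{X}}f(x,\eta+\delta_x)\,\kappa(x,\eta)\,\mathrm{d}\lambda(x)]$ for all measurable $f:\mathbb{X}\times\mathbf{N}\to[0,\infty]$. *)

theory Defs
  imports "HOL-Probability.Probability" "HOL-Combinatorics.Permutations"
begin

text \<open>
  The measurable space is represented by a value \<open>X\<close> of type \<open>'a measure\<close> of which only
  \<open>space X\<close> and \<open>sets X\<close> matter; \<open>B 0\<close>, \<open>B 1\<close>, \dots are the localizing sets.
\<close>

definition localizing :: "'a measure \<Rightarrow> (nat \<Rightarrow> 'a set) \<Rightarrow> bool" where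
  "localizing X B \<longleftrightarrow> (\<forall>j. B j \<in> sets X) \<and> incseq B \<and> (\<Union>j. B j) = space X"

definition bounded_sets :: "'a measure \<Rightarrow> (nat \<Rightarrow> 'a set) \<Rightarrow> 'a set set" where
  "bounded_sets X B = {A \<in> sets X. \<exists>j. A \<subseteq> B j}"

definition locally_finite_measure :: "'a measure \<Rightarrow> (nat \<Rightarrow> 'a set) \<Rightarrow> 'a measure \<Rightarrow> bool" where
  "locally_finite_measure X B \<mu> \<longleftrightarrow>
     sets \<mu> = sets X \<and> (\<forall>A\<in>bounded_sets X B. emeasure \<mu> A < \<infinity>)"

definition measurable_diagonal :: "'a measure \<Rightarrow> bool" where
  "measurable_diagonal X \<longleftrightarrow> {(x, x) | x. x \<in> space X} \<in> sets (X \<Otimes>\<^sub>M X)"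

definition counting_measures :: "'a measure \<Rightarrow> (nat \<Rightarrow> 'a set) \<Rightarrow> 'a measure set" where
  "counting_measures X B =
     {\<mu>. sets \<mu> = sets X \<and> (\<forall>A\<in>bounded_sets X B. \<exists>n::nat. emeasure \<mu> A = of_nat n)}"

definition counting_algebra :: "'a measure \<Rightarrow> (nat \<Rightarrow> 'a set) \<Rightarrow> 'a measure measure" where
  "counting_algebra X B = sigma (counting_measures X B)
     {(\<lambda>\<mu>. emeasure \<mu> A) -` C \<inter> counting_measures X B | A C.
        A \<in> sets X \<and> C \<in> sets (borel :: ennreal measure)}"

text \<open>Sums of measures on the same \<open>\<sigma>\<close>-field; the Dirac measure in \<open>x\<close> is \<open>return X x\<close>.\<close>

definition plus_measure :: "'a measure \<Rightarrow> 'a measure \<Rightarrow> 'a measure" where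
  "plus_measure \<mu> \<nu> = measure_of (space \<mu>) (sets \<mu>) (\<lambda>A. emeasure \<mu> A + emeasure \<nu> A)"

definition dirac_sum :: "'a measure \<Rightarrow> 'i set \<Rightarrow> ('i \<Rightarrow> 'a) \<Rightarrow> 'a measure" where
  "dirac_sum X J x = measure_of (space X) (sets X) (\<lambda>A. \<Sum>j\<in>J. emeasure (return X (x j)) A)"

definition point_process ::
  "'w measure \<Rightarrow> 'a measure \<Rightarrow> (nat \<Rightarrow> 'a set) \<Rightarrow> ('w \<Rightarrow> 'a measure) \<Rightarrow> bool" where
  "point_process M X B \<eta> \<longleftrightarrow> prob_space M \<and> \<eta> \<in> measurable M (counting_algebra X B)"

definition gibbs_process ::
  "'w measure \<Rightarrow> 'a measure \<Rightarrow> (nat \<Rightarrow> 'a set) \<Rightarrow> 'a measure \<Rightarrow>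
   ('a \<Rightarrow> 'a measure \<Rightarrow> real) \<Rightarrow> ('w \<Rightarrow> 'a measure) \<Rightarrow> bool" where
  "gibbs_process M X B \<Lambda> \<kappa> \<eta> \<longleftrightarrow> point_process M X B \<eta> \<and>
     (\<forall>f :: 'a \<times> 'a measure \<Rightarrow> ennreal. f \<in> borel_measurable (X \<Otimes>\<^sub>M counting_algebra X B) \<longrightarrow>
        (\<integral>\<^sup>+\<omega>. (\<integral>\<^sup>+x. f (x, \<eta> \<omega>) \<partial>(\<eta> \<omega>)) \<partial>M) =
        (\<integral>\<^sup>+\<omega>. (\<integral>\<^sup>+x. f (x, plus_measure (\<eta> \<omega>) (return X x)) * ennreal (\<kappa> x (\<eta> \<omega>)) \<partial>\<Lambda>) \<partial>M))"

text \<open>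
  Points \<open>x\<^sub>1, \<dots>, x\<^sub>m\<close> are given by a function on \<open>{1..m}\<close>. The factor with index \<open>i\<close> is
  \<open>\<kappa>(x\<^sub>i, \<mu> + \<delta>(x\<^sub>i\<^sub>+\<^sub>1) + \<dots> + \<delta>(x\<^sub>m))\<close>.
\<close>

definition kappa_iter ::
  "'a measure \<Rightarrow> ('a \<Rightarrow> 'a measure \<Rightarrow> real) \<Rightarrow> nat \<Rightarrow> (nat \<Rightarrow> 'a) \<Rightarrow> 'a measure \<Rightarrow> real" where
  "kappa_iter X \<kappa> m x \<mu> = (\<Prod>i=1..m. \<kappa> (x i) (plus_measure \<mu> (dirac_sum X {i<..m} x)))"

lemma space_plus_measure [simp]: "space (plus_measure \<mu> \<nu>) = space \<mu>"
  and sets_plus_measure [simp]: "sets (plus_measure \<mu> \<nu>) = sets \<mu>"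
  by (simp_all add: plus_measure_def)

lemma emeasure_plus_measure:
  assumes "sets \<nu> = sets \<mu>" "A \<in> sets \<mu>"
  shows "emeasure (plus_measure \<mu> \<nu>) A = emeasure \<mu> A + emeasure \<nu> A"
proof (rule emeasure_measure_of[OF plus_measure_def])
  show "countably_additive (sets (plus_measure \<mu> \<nu>)) (\<lambda>A. emeasure \<mu> A + emeasure \<nu> A)"
    unfolding countably_additive_def
  proof (intro allI impI)
    fix F :: "nat \<Rightarrow> 'a set"
    assume F: "range F \<subseteq> sets (plus_measure \<mu> \<nu>)" "disjoint_family F"
    show "(\<Sum>i. emeasure \<mu> (F i) + emeasure \<nu> (F i)) = emeasure \<mu> (\<Union>i. F i) + emeasure \<nu> (\<Union>i. F i)"
      using F assms(1) by (subst suminf_add[symmetric]) (auto intro!: arg_cong2[where f="(+)"] suminf_emeasure)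
  qed
qed (use assms sets.space_closed in \<open>auto simp: positive_def\<close>)

lemma space_dirac_sum [simp]: "space (dirac_sum X J x) = space X"
  and sets_dirac_sum [simp]: "sets (dirac_sum X J x) = sets X"
  by (simp_all add: dirac_sum_def)

lemma emeasure_dirac_sum:
  assumes "A \<in> sets X"
  shows "emeasure (dirac_sum X J x) A = (\<Sum>j\<in>J. indicator A (x j))"
proof -
  have "emeasure (dirac_sum X J x) A = (\<Sum>j\<in>J. emeasure (return X (x j)) A)"
  proof (rule emeasure_measure_of[OF dirac_sum_def])
    show "countably_additive (sets (dirac_sum X J x)) (\<lambda>A. \<Sum>j\<in>J. emeasure (return X (x j)) A)"
      unfolding countably_additive_def
    proof (intro allI impI)
      fix F :: "nat \<Rightarrow> 'a set"
      assume F: "range F \<subseteq> sets (dirac_sum X J x)" "disjoint_family F"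
      have "(\<Sum>i. \<Sum>j\<in>J. emeasure (return X (x j)) (F i)) = (\<Sum>j\<in>J. \<Sum>i. emeasure (return X (x j)) (F i))"
        by (rule suminf_sum) simp
      also have "\<dots> = (\<Sum>j\<in>J. emeasure (return X (x j)) (\<Union>i. F i))"
        using F by (intro sum.cong refl suminf_emeasure) auto
      finally show "(\<Sum>i. \<Sum>j\<in>J. emeasure (return X (x j)) (F i)) = (\<Sum>j\<in>J. emeasure (return X (x j)) (\<Union>i. F i))" .
    qed
  qed (use assms sets.space_closed in \<open>auto simp: positive_def\<close>)
  with assms show ?thesis by simp
qed

end

theory Submission
  imports Defs
begin

text \<open>
  Although no cocycle relation is assumed, the Gibbs property forces one. Let \<open>D\<close> be the law of
  \<open>\<eta>\<close>. The heart of the matter is the case of two points: for \<open>D\<close>-almost every \<open>\<mu>\<close> and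
  \<open>\<Lambda>\<close>-almost all \<open>y\<close>, \<open>x\<close>,
  \<open>\<kappa> x (\<mu> + \<delta>\<^sub>y) * \<kappa> y \<mu> = \<kappa> y (\<mu> + \<delta>\<^sub>x) * \<kappa> x \<mu>\<close>
  (\<open>AE_two_points_commute\<close>). Using the defining equation of the Gibbs process twice shows that, for
  \<open>g\<close> vanishing on the diagonal \<open>y = x\<close>, the integral of \<open>g (\<mu> + \<delta>\<^sub>y + \<delta>\<^sub>x) y x\<close> against the
  left-hand side equals the integral of \<open>g \<mu> y x\<close> against \<open>\<mu> \<otimes> \<mu>\<close>, averaged over \<open>D\<close>
  (\<open>second_order_GNZ\<close>). The latter does not change when \<open>g\<close> is replaced by \<open>g\<close> with \<open>x\<close> and \<open>y\<close>
  exchanged, because \<open>\<mu> \<otimes> \<mu>\<close> is symmetric. Every measurable function of \<open>(\<mu>, y, x)\<close> can be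
  written as a measurable function of \<open>(\<mu> + \<delta>\<^sub>y + \<delta>\<^sub>x, y, x)\<close> (\<open>sets_add_two_points\<close>), so both
  sides of the two-point identity are densities of the same measure off the diagonal and hence
  agree there almost everywhere; on the diagonal they are trivially equal. This is where the
  diagonal has to be measurable.

  The general case follows by induction on the number of points. Adding a point drawn from
  \<open>\<kappa> x \<mu> \<Lambda>(dx)\<close> cannot lead into a \<open>D\<close>-null set (\<open>AE_add_point\<close>), so the induction hypothesis
  holds at \<open>\<mu> + \<delta>\<^sub>x\<close> unless \<open>\<kappa> x \<mu> = 0\<close>. As \<open>x\<^sub>m\<^sub>+\<^sub>1\<close> is the first point to be added, this gives
  invariance of the \<open>m + 1\<close> point function under permutations that fix the last index, while the
  two-point identity gives invariance under the exchange of the last two indices. Together these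
  generate all permutations.
\<close>

section \<open>Almost everywhere statements on finite products\<close>

lemma (in product_sigma_finite) AE_PiM_insert:
  assumes I: "finite I" "i \<notin> I"
    and P: "{x \<in> space (Pi\<^sub>M (insert i I) M). P x} \<in> sets (Pi\<^sub>M (insert i I) M)"
    and ae: "AE y in M i. AE x in Pi\<^sub>M I M. P (x(i := y))"
  shows "AE x in Pi\<^sub>M (insert i I) M. P x"
proof -
  let ?S = "{x \<in> space (Pi\<^sub>M (insert i I) M). \<not> P x}"
  have S [measurable]: "?S \<in> sets (Pi\<^sub>M (insert i I) M)"
    using P by (rule sets.sets_Collect_neg)
  have "emeasure (Pi\<^sub>M (insert i I) M) ?S = (\<integral>\<^sup>+y. \<integral>\<^sup>+x. indicator ?S (x(i := y)) \<partial>Pi\<^sub>M I M \<partial>M i)"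
    using I S by (subst product_nn_integral_insert_rev[symmetric]) auto
  also have "\<dots> = (\<integral>\<^sup>+y. 0 \<partial>M i)"
  proof (rule nn_integral_cong_AE)
    show "AE y in M i. (\<integral>\<^sup>+x. indicator ?S (x(i := y)) \<partial>Pi\<^sub>M I M) = 0"
      using ae
    proof eventually_elim
      case (elim y)
      then have "(\<integral>\<^sup>+x. indicator ?S (x(i := y)) \<partial>Pi\<^sub>M I M) = (\<integral>\<^sup>+x. 0 \<partial>Pi\<^sub>M I M)"
        by (intro nn_integral_cong_AE, eventually_elim) auto
      then show ?case by simp
    qed
  qed
  finally show ?thesis
    using S by (intro AE_I[of _ _ ?S]) auto
qed

text \<open>
  Permuting coordinates preserves a power of a \<open>\<sigma>\<close>-finite measure, since it permutes the sides of
  each measurable box.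
\<close>

lemma AE_PiM_permute:
  fixes L :: "'a measure" and I :: "'i set"
  assumes L: "sigma_finite_measure L" and I: "finite I" and \<tau>: "\<tau> permutes I"
    and ae: "AE x in \<Pi>\<^sub>M i\<in>I. L. P x"
  shows "AE x in \<Pi>\<^sub>M i\<in>I. L. P (x \<circ> \<tau>)"
proof -
  interpret product_sigma_finite "\<lambda>_::'i. L"
    using L by (simp add: product_sigma_finite_def)
  have \<tau>I: "\<tau> i \<in> I \<longleftrightarrow> i \<in> I" for i
    using \<tau> by (rule permutes_in_image)
  have "(\<lambda>x. \<lambda>i\<in>I. x (\<tau> i)) \<in> (\<Pi>\<^sub>M i\<in>I. L) \<rightarrow>\<^sub>M (\<Pi>\<^sub>M i\<in>I. L)"
    using \<tau>I by (intro measurable_restrict measurable_component_singleton) auto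
  moreover have "x \<circ> \<tau> = (\<lambda>i\<in>I. x (\<tau> i))" if "x \<in> space (\<Pi>\<^sub>M i\<in>I. L)" for x
    using that \<tau>I by (auto simp: space_PiM PiE_def extensional_def fun_eq_iff)
  ultimately have m: "(\<lambda>x. x \<circ> \<tau>) \<in> (\<Pi>\<^sub>M i\<in>I. L) \<rightarrow>\<^sub>M (\<Pi>\<^sub>M i\<in>I. L)"
    by (simp cong: measurable_cong)
  have distr: "distr (\<Pi>\<^sub>M i\<in>I. L) (\<Pi>\<^sub>M i\<in>I. L) (\<lambda>x. x \<circ> \<tau>) = (\<Pi>\<^sub>M i\<in>I. L)"
  proof (rule PiM_eqI[OF I])
    fix A assume A: "\<And>i. i \<in> I \<Longrightarrow> A i \<in> sets L"
    have inv: "inv \<tau> permutes I" using \<tau> by (rule permutes_inv)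
    have A': "A (inv \<tau> i) \<in> sets L" if "i \<in> I" for i
      using A permutes_in_image[OF inv, of i] that by auto
    have pre: "(\<lambda>x. x \<circ> \<tau>) -` Pi\<^sub>E I A \<inter> space (\<Pi>\<^sub>M i\<in>I. L) = (\<Pi>\<^sub>E i\<in>I. A (inv \<tau> i))"
    proof (intro set_eqI iffI)
      fix x assume x: "x \<in> (\<lambda>x. x \<circ> \<tau>) -` Pi\<^sub>E I A \<inter> space (\<Pi>\<^sub>M i\<in>I. L)"
      have "x i \<in> A (inv \<tau> i)" if "i \<in> I" for i
      proof -
        have "inv \<tau> i \<in> I" using permutes_in_image[OF inv, of i] that by simp
        then have "(x \<circ> \<tau>) (inv \<tau> i) \<in> A (inv \<tau> i)" using x by blast
        then show ?thesis by (simp add: permutes_inverses[OF \<tau>])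
      qed
      then show "x \<in> (\<Pi>\<^sub>E i\<in>I. A (inv \<tau> i))"
        using x by (auto simp: space_PiM PiE_def)
    next
      fix x assume x: "x \<in> (\<Pi>\<^sub>E i\<in>I. A (inv \<tau> i))"
      have "x (\<tau> i) \<in> A i" if "i \<in> I" for i
      proof -
        have "x (\<tau> i) \<in> A (inv \<tau> (\<tau> i))" using x \<tau>I that by blast
        then show ?thesis by (simp add: permutes_inverses[OF \<tau>])
      qed
      moreover have "x i \<in> space L" if "i \<in> I" for i
        using x A'[OF that] sets.sets_into_space that by blast
      ultimately show "x \<in> (\<lambda>x. x \<circ> \<tau>) -` Pi\<^sub>E I A \<inter> space (\<Pi>\<^sub>M i\<in>I. L)"
        using x \<tau>I by (auto simp: space_PiM PiE_def extensional_def)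
    qed
    have "emeasure (distr (\<Pi>\<^sub>M i\<in>I. L) (\<Pi>\<^sub>M i\<in>I. L) (\<lambda>x. x \<circ> \<tau>)) (Pi\<^sub>E I A) = (\<Prod>i\<in>I. emeasure L (A (inv \<tau> i)))"
      using m A A' I by (simp add: emeasure_distr pre emeasure_PiM sets_PiM_I_finite)
    also have "\<dots> = (\<Prod>i\<in>I. emeasure L (A i))"
      using prod.permute[OF inv, of "\<lambda>i. emeasure L (A i)"] by (simp add: o_def)
    finally show "emeasure (distr (\<Pi>\<^sub>M i\<in>I. L) (\<Pi>\<^sub>M i\<in>I. L) (\<lambda>x. x \<circ> \<tau>)) (Pi\<^sub>E I A) = (\<Prod>i\<in>I. emeasure L (A i))" .
  qed simp
  have "AE x in distr (\<Pi>\<^sub>M i\<in>I. L) (\<Pi>\<^sub>M i\<in>I. L) (\<lambda>x. x \<circ> \<tau>). P x"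
    unfolding distr by (rule ae)
  then show ?thesis
    by (rule AE_distrD[OF m])
qed

section \<open>Localized spaces and their counting measures\<close>

lemma emeasure_plus_dirac:
  assumes "sets \<mu> = sets X" "A \<in> sets X"
  shows "emeasure (plus_measure \<mu> (return X x)) A = emeasure \<mu> A + indicator A x"
  using assms by (subst emeasure_plus_measure) auto

lemma plus_dirac_commute:
  assumes "sets \<mu> = sets X"
  shows "plus_measure (plus_measure \<mu> (return X x)) (return X y) =
         plus_measure (plus_measure \<mu> (return X y)) (return X x)"
  using assms by (intro measure_eqI) (auto simp: emeasure_plus_dirac ac_simps)

lemma emeasure_plus_dirac_sum:
  assumes "sets \<mu> = sets X" "A \<in> sets X"
  shows "emeasure (plus_measure \<mu> (dirac_sum X J x)) A = emeasure \<mu> A + (\<Sum>j\<in>J. indicator A (x j))"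
  using assms by (subst emeasure_plus_measure) (auto simp: emeasure_dirac_sum)

lemma nn_integral_plus_dirac:
  assumes \<mu>: "sets \<mu> = sets X" and x: "x \<in> space X" and f: "f \<in> borel_measurable X"
  shows "(\<integral>\<^sup>+y. f y \<partial>plus_measure \<mu> (return X x)) = (\<integral>\<^sup>+y. f y \<partial>\<mu>) + f x"
  using f
proof (induction rule: borel_measurable_induct)
  case (cong f g)
  then show ?case
    using x nn_integral_cong[of "plus_measure \<mu> (return X x)" f g] nn_integral_cong[of \<mu> f g]
      sets_eq_imp_space_eq[OF \<mu>] by auto
next
  case (set A)
  then show ?case
    using \<mu> by (simp add: emeasure_plus_dirac)
next
  case (mult u c)
  then show ?case
    by (simp add: nn_integral_cmult distrib_left measurable_cong_sets[OF \<mu> refl] measurable_cong_sets[OF sets_plus_measure refl])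
next
  case (add u v)
  then show ?case
    by (simp add: nn_integral_add ac_simps measurable_cong_sets[OF \<mu> refl] measurable_cong_sets[OF sets_plus_measure refl])
next
  case (seq U)
  have m: "U i \<in> borel_measurable \<mu>" "U i \<in> borel_measurable (plus_measure \<mu> (return X x))" for i
    using seq by (auto simp: measurable_cong_sets[OF \<mu> refl] measurable_cong_sets[OF sets_plus_measure refl])
  have "(\<integral>\<^sup>+y. (SUP i. U i y) \<partial>plus_measure \<mu> (return X x)) = (SUP i. (\<integral>\<^sup>+y. U i y \<partial>\<mu>) + U i x)"
    using m seq by (subst nn_integral_monotone_convergence_SUP) auto
  also have "\<dots> = (SUP i. \<integral>\<^sup>+y. U i y \<partial>\<mu>) + (SUP i. U i x)"
    using seq by (intro ennreal_SUP_add) (auto simp: incseq_def le_fun_def intro!: nn_integral_mono)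
  finally show ?case
    using m seq by (simp add: nn_integral_monotone_convergence_SUP image_comp SUP_apply[abs_def])
qed

locale localized_space =
  fixes X :: "'a measure" and B :: "nat \<Rightarrow> 'a set"
  assumes localizing: "localizing X B"
begin

abbreviation N :: "'a measure measure" where
  "N \<equiv> counting_algebra X B"

abbreviation add_point :: "'a measure \<Rightarrow> 'a \<Rightarrow> 'a measure" where
  "add_point \<mu> x \<equiv> plus_measure \<mu> (return X x)"

lemma sets_B [measurable]: "B j \<in> sets X"
  and B_mono: "i \<le> j \<Longrightarrow> B i \<subseteq> B j"
  and UN_B: "(\<Union>j. B j) = space X"
  using localizing by (auto simp: localizing_def incseq_def)

lemma space_N: "space N = counting_measures X B"
  by (simp add: counting_algebra_def space_measure_of_conv)

lemma sets_counting_measure: "\<mu> \<in> counting_measures X B \<Longrightarrow> sets \<mu> = sets X"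
  by (simp add: counting_measures_def)

lemma space_counting_measure: "\<mu> \<in> counting_measures X B \<Longrightarrow> space \<mu> = space X"
  by (metis sets_counting_measure sets_eq_imp_space_eq)

lemma measurable_emeasure_N [measurable]:
  assumes "A \<in> sets X"
  shows "(\<lambda>\<mu>. emeasure \<mu> A) \<in> borel_measurable N"
proof (rule measurableI)
  fix C :: "ennreal set" assume "C \<in> sets borel"
  then have "(\<lambda>\<mu>. emeasure \<mu> A) -` C \<inter> counting_measures X B \<in>
      sigma_sets (counting_measures X B) {(\<lambda>\<mu>. emeasure \<mu> A) -` C \<inter> counting_measures X B | A C.
        A \<in> sets X \<and> C \<in> sets (borel :: ennreal measure)}"
    using assms by (intro sigma_sets.Basic) auto
  then show "(\<lambda>\<mu>. emeasure \<mu> A) -` C \<inter> space N \<in> sets N"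
    unfolding space_N unfolding counting_algebra_def by (subst sets_measure_of) auto
qed simp

lemma measurable_into_N:
  assumes "\<And>w. w \<in> space W \<Longrightarrow> f w \<in> counting_measures X B"
    and "\<And>A. A \<in> sets X \<Longrightarrow> (\<lambda>w. emeasure (f w) A) \<in> borel_measurable W"
  shows "f \<in> W \<rightarrow>\<^sub>M N"
  unfolding counting_algebra_def
proof (rule measurable_measure_of)
  fix Y assume "Y \<in> {(\<lambda>\<mu>. emeasure \<mu> A) -` C \<inter> counting_measures X B | A C.
        A \<in> sets X \<and> C \<in> sets (borel :: ennreal measure)}"
  then obtain A C where Y: "Y = (\<lambda>\<mu>. emeasure \<mu> A) -` C \<inter> counting_measures X B"
    "A \<in> sets X" "C \<in> sets borel" by auto
  have "f -` Y \<inter> space W = (\<lambda>w. emeasure (f w) A) -` C \<inter> space W"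
    using assms(1) Y(1) by auto
  also have "\<dots> \<in> sets W"
    using assms(2)[OF Y(2)] Y(3) by (rule measurable_sets)
  finally show "f -` Y \<inter> space W \<in> sets W" .
qed (use assms(1) in auto)

lemma sigma_finite_locally_finite:
  assumes "locally_finite_measure X B \<mu>"
  shows "sigma_finite_measure \<mu>"
proof
  have "space \<mu> = space X"
    using assms sets_eq_imp_space_eq unfolding locally_finite_measure_def by blast
  moreover have "B j \<in> bounded_sets X B" for j
    by (auto simp: bounded_sets_def)
  ultimately show "\<exists>A. countable A \<and> A \<subseteq> sets \<mu> \<and> \<Union>A = space \<mu> \<and> (\<forall>a\<in>A. emeasure \<mu> a \<noteq> \<infinity>)"
    using assms UN_B by (intro exI[of _ "range B"]) (auto simp: locally_finite_measure_def less_top)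
qed

lemma counting_imp_locally_finite:
  "\<mu> \<in> counting_measures X B \<Longrightarrow> locally_finite_measure X B \<mu>"
  unfolding counting_measures_def locally_finite_measure_def
  by (auto simp: less_top[symmetric])

lemma sigma_finite_counting: "\<mu> \<in> counting_measures X B \<Longrightarrow> sigma_finite_measure \<mu>"
  using sigma_finite_locally_finite counting_imp_locally_finite by blast

lemma emeasure_B_finite: "\<mu> \<in> counting_measures X B \<Longrightarrow> emeasure \<mu> (B j) < \<infinity>"
  using counting_imp_locally_finite[of \<mu>] sets_B[of j]
  unfolding bounded_sets_def locally_finite_measure_def by blast

lemma plus_dirac_sum_counting:
  assumes "\<mu> \<in> counting_measures X B"
  shows "plus_measure \<mu> (dirac_sum X J x) \<in> counting_measures X B"
  unfolding counting_measures_def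
proof (intro CollectI conjI ballI)
  fix A assume A: "A \<in> bounded_sets X B"
  then obtain n :: nat where "emeasure \<mu> A = of_nat n"
    using assms unfolding counting_measures_def by blast
  moreover have "(\<Sum>j\<in>J. indicator A (x j) :: ennreal) = of_nat (\<Sum>j\<in>J. indicator A (x j))"
    unfolding of_nat_sum by (intro sum.cong) (auto split: split_indicator)
  ultimately have "emeasure (plus_measure \<mu> (dirac_sum X J x)) A = of_nat (n + (\<Sum>j\<in>J. indicator A (x j)))"
    using A sets_counting_measure[OF assms]
    by (subst emeasure_plus_dirac_sum) (auto simp: bounded_sets_def)
  then show "\<exists>n::nat. emeasure (plus_measure \<mu> (dirac_sum X J x)) A = of_nat n" ..
qed (simp add: sets_counting_measure[OF assms])

lemma add_point_eq_dirac_sum: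
  "sets \<mu> = sets X \<Longrightarrow> add_point \<mu> x = plus_measure \<mu> (dirac_sum X {()} (\<lambda>_. x))"
  by (rule measure_eqI) (auto simp: emeasure_plus_dirac emeasure_plus_dirac_sum)

lemma add_point_counting:
  "\<mu> \<in> counting_measures X B \<Longrightarrow> add_point \<mu> x \<in> counting_measures X B"
  using plus_dirac_sum_counting by (simp add: add_point_eq_dirac_sum sets_counting_measure)

lemma measurable_add_point [measurable (raw)]:
  assumes f: "f \<in> W \<rightarrow>\<^sub>M N" and g: "g \<in> W \<rightarrow>\<^sub>M X"
  shows "(\<lambda>w. add_point (f w) (g w)) \<in> W \<rightarrow>\<^sub>M N"
proof (rule measurable_into_N)
  note [measurable] = f g
  fix w assume "w \<in> space W"
  then show "add_point (f w) (g w) \<in> counting_measures X B"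
    using measurable_space[OF f] by (auto simp: space_N intro: add_point_counting)
next
  note [measurable] = f g
  fix A assume A[measurable]: "A \<in> sets X"
  have "(\<lambda>w. emeasure (f w) A + indicator A (g w)) \<in> borel_measurable W"
    by measurable
  then show "(\<lambda>w. emeasure (add_point (f w) (g w)) A) \<in> borel_measurable W"
    using measurable_space[OF f] A
    by (subst measurable_cong) (auto simp: space_N emeasure_plus_dirac sets_counting_measure)
qed

lemma measurable_plus_dirac_sum:
  assumes f[measurable]: "f \<in> W \<rightarrow>\<^sub>M N" and g[measurable]: "\<And>j. j \<in> J \<Longrightarrow> (\<lambda>w. g w j) \<in> W \<rightarrow>\<^sub>M X"
  shows "(\<lambda>w. plus_measure (f w) (dirac_sum X J (g w))) \<in> W \<rightarrow>\<^sub>M N"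
proof (rule measurable_into_N)
  fix w assume "w \<in> space W"
  then show "plus_measure (f w) (dirac_sum X J (g w)) \<in> counting_measures X B"
    using measurable_space[OF f] by (auto simp: space_N intro: plus_dirac_sum_counting)
next
  fix A assume A[measurable]: "A \<in> sets X"
  have "(\<lambda>w. emeasure (f w) A + (\<Sum>j\<in>J. indicator A (g w j))) \<in> borel_measurable W"
    by measurable
  then show "(\<lambda>w. emeasure (plus_measure (f w) (dirac_sum X J (g w))) A) \<in> borel_measurable W"
    using measurable_space[OF f] A
    by (subst measurable_cong) (auto simp: space_N emeasure_plus_dirac_sum sets_counting_measure)
qed

text \<open>
  Integration with respect to a random counting measure is measurable even jointly with a
  parameter. Restricted to \<open>B j\<close> and divided by their mass there plus one, the counting measures
  form a subprobability kernel, for which this is a standard fact. The divisor is measurable and is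
  multiplied back afterwards, and monotone convergence removes the restriction.
\<close>

lemma measurable_nn_integral_counting:
  assumes \<nu>: "\<nu> \<in> W \<rightarrow>\<^sub>M N" and g: "(\<lambda>(w, x). g w x) \<in> borel_measurable (W \<Otimes>\<^sub>M X)"
  shows "(\<lambda>w. \<integral>\<^sup>+x. g w x \<partial>\<nu> w) \<in> borel_measurable W"
proof (cases "space X = {}")
  case True
  have "(\<integral>\<^sup>+x. g w x \<partial>\<nu> w) = 0" if "w \<in> space W" for w
    using measurable_space[OF \<nu> that] True
    by (intro nn_integral_empty) (auto simp: space_N space_counting_measure)
  then show ?thesis
    by (subst measurable_cong[of _ _ "\<lambda>_. 0"]) auto
next
  case False
  note [measurable] = \<nu> g
  have cm: "\<nu> w \<in> counting_measures X B" if "w \<in> space W" for w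
    using measurable_space[OF \<nu> that] by (simp add: space_N)
  have gw: "g w \<in> borel_measurable (\<nu> w)" if "w \<in> space W" for w
    using measurable_Pair2[OF g that] cm[OF that]
    by (simp add: measurable_cong_sets[OF sets_counting_measure refl])
  have part: "(\<lambda>w. \<integral>\<^sup>+x. indicator (B j) x * g w x \<partial>\<nu> w) \<in> borel_measurable W" for j
  proof -
    define c where "c w = emeasure (\<nu> w) (B j) + 1" for w
    define K where "K w = density (\<nu> w) (\<lambda>x. inverse (c w) * indicator (B j) x)" for w
    have c: "c w \<noteq> 0" "c w \<noteq> \<infinity>" if "w \<in> space W" for w
      using emeasure_B_finite[OF cm[OF that], of j] by (auto simp: c_def)
    have K: "emeasure (K w) A = inverse (c w) * emeasure (\<nu> w) (A \<inter> B j)"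
      if "w \<in> space W" "A \<in> sets X" for w A
    proof -
      have [measurable]: "A \<in> sets (\<nu> w)" "B j \<in> sets (\<nu> w)"
        using that cm[of w] by (auto simp: sets_counting_measure)
      have "emeasure (K w) A = (\<integral>\<^sup>+x. inverse (c w) * indicator (A \<inter> B j) x \<partial>\<nu> w)"
        unfolding K_def by (subst emeasure_density) (auto intro!: nn_integral_cong split: split_indicator)
      then show ?thesis by (simp add: nn_integral_cmult_indicator)
    qed
    have "K \<in> W \<rightarrow>\<^sub>M subprob_algebra X"
    proof (rule measurable_subprob_algebra)
      fix w assume w: "w \<in> space W"
      show *: "sets (K w) = sets X"
        using cm[OF w] by (simp add: K_def sets_counting_measure)
      show "subprob_space (K w)"
      proof
        have "emeasure (K w) (space X) \<le> inverse (c w) * c w"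
          unfolding K[OF w sets.top] by (intro mult_left_mono) (auto simp: c_def sets.Int_space_eq1)
        also have "\<dots> = 1"
          using c[OF w] by (metis ennreal_divide_self ennreal_times_divide mult.commute divide_ennreal_def top.not_eq_extremum infinity_ennreal_def)
        finally show "emeasure (K w) (space (K w)) \<le> 1"
          using sets_eq_imp_space_eq[OF *] by simp
        show "space (K w) \<noteq> {}"
          using sets_eq_imp_space_eq[OF *] False by simp
      qed
    next
      fix A assume A: "A \<in> sets X"
      then have [measurable]: "A \<inter> B j \<in> sets X" by auto
      have "(\<lambda>w. inverse (c w) * emeasure (\<nu> w) (A \<inter> B j)) \<in> borel_measurable W"
        unfolding c_def by measurable
      then show "(\<lambda>w. emeasure (K w) A) \<in> borel_measurable W"
        using A by (subst measurable_cong) (auto simp: K)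
    qed
    then have "(\<lambda>w. \<integral>\<^sup>+x. g w x \<partial>K w) \<in> borel_measurable W"
      using g by (intro nn_integral_measurable_subprob_algebra2[where N=X]) auto
    then have "(\<lambda>w. c w * (\<integral>\<^sup>+x. g w x \<partial>K w)) \<in> borel_measurable W"
      unfolding c_def by measurable
    moreover have "c w * (\<integral>\<^sup>+x. g w x \<partial>K w) = (\<integral>\<^sup>+x. indicator (B j) x * g w x \<partial>\<nu> w)"
      if w: "w \<in> space W" for w
    proof -
      note [measurable] = gw[OF w]
      have [measurable]: "B j \<in> sets (\<nu> w)"
        using cm[OF w] by (auto simp: sets_counting_measure)
      have "c w * inverse (c w) = 1"
        using c[OF w] by (metis ennreal_divide_self ennreal_times_divide mult.commute divide_ennreal_def top.not_eq_extremum infinity_ennreal_def)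
      then show ?thesis
        unfolding K_def
        by (subst nn_integral_density) (auto simp: nn_integral_cmult[symmetric] mult.assoc[symmetric])
    qed
    ultimately show ?thesis by (simp cong: measurable_cong)
  qed
  have "(\<integral>\<^sup>+x. g w x \<partial>\<nu> w) = (SUP j. \<integral>\<^sup>+x. indicator (B j) x * g w x \<partial>\<nu> w)" if w: "w \<in> space W" for w
  proof -
    note [measurable] = gw[OF w]
    have [measurable]: "B j \<in> sets (\<nu> w)" for j
      using cm[OF w] by (auto simp: sets_counting_measure)
    have "(SUP j. indicator (B j) x * g w x) = g w x" if "x \<in> space (\<nu> w)" for x
    proof -
      have "x \<in> (\<Union>j. B j)"
        using that cm[OF w] unfolding UN_B by (simp add: space_counting_measure)
      then obtain j where "x \<in> B j" by blast
      then show ?thesis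
        by (intro antisym SUP_least SUP_upper2[of j]) (auto split: split_indicator)
    qed
    then have "(\<integral>\<^sup>+x. g w x \<partial>\<nu> w) = (\<integral>\<^sup>+x. (SUP j. indicator (B j) x * g w x) \<partial>\<nu> w)"
      by (intro nn_integral_cong) auto
    also have "\<dots> = (SUP j. \<integral>\<^sup>+x. indicator (B j) x * g w x \<partial>\<nu> w)"
      using B_mono by (intro nn_integral_monotone_convergence_SUP)
        (auto simp: incseq_def le_fun_def split: split_indicator)
    finally show ?thesis .
  qed
  then show ?thesis
    using part by (subst measurable_cong) auto
qed

text \<open>
  The map \<open>T\<close> sending \<open>(\<mu>, y, x)\<close> to \<open>(\<mu> + \<delta>\<^sub>y + \<delta>\<^sub>x, y, x)\<close> loses no measurable information: the coordinates
  \<open>y\<close> and \<open>x\<close> are measurable with respect to the \<open>\<sigma>\<close>-field generated by \<open>T\<close>, and so is each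
  \<open>\<mu>(A)\<close>, being equal to
  \<open>(\<mu> + \<delta>\<^sub>y + \<delta>\<^sub>x)(A) - (\<delta>\<^sub>y + \<delta>\<^sub>x)(A)\<close>.
\<close>

lemma sets_add_two_points:
  assumes "S \<in> sets (N \<Otimes>\<^sub>M (X \<Otimes>\<^sub>M X))"
  shows "\<exists>E \<in> sets (N \<Otimes>\<^sub>M (X \<Otimes>\<^sub>M X)). \<forall>\<mu>\<in>space N. \<forall>y\<in>space X. \<forall>x\<in>space X.
           (\<mu>, y, x) \<in> S \<longleftrightarrow> (add_point (add_point \<mu> y) x, y, x) \<in> E"
proof -
  let ?T = "\<lambda>(\<mu>, y, x). (add_point (add_point \<mu> y) x, y, x)"
  let ?W = "N \<Otimes>\<^sub>M (X \<Otimes>\<^sub>M X)"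
  let ?V = "vimage_algebra (space ?W) ?T ?W"
  have T: "?T \<in> ?W \<rightarrow>\<^sub>M ?W" by measurable
  have TV [measurable]: "?T \<in> ?V \<rightarrow>\<^sub>M ?W"
    using measurable_space[OF T] by (intro measurable_vimage_algebra1) auto
  have snd [measurable]: "snd \<in> ?V \<rightarrow>\<^sub>M X \<Otimes>\<^sub>M X"
  proof -
    have "(\<lambda>w. snd (?T w)) \<in> ?V \<rightarrow>\<^sub>M X \<Otimes>\<^sub>M X" by measurable
    then show ?thesis by (simp add: case_prod_beta')
  qed
  have y [measurable]: "(\<lambda>w. fst (snd w)) \<in> ?V \<rightarrow>\<^sub>M X" and x [measurable]: "(\<lambda>w. snd (snd w)) \<in> ?V \<rightarrow>\<^sub>M X"
    by measurable
  have "fst \<in> ?V \<rightarrow>\<^sub>M N"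
  proof (rule measurable_into_N)
    fix A assume A [measurable]: "A \<in> sets X"
    have *: "(\<lambda>w. emeasure (fst (?T w)) A - (indicator A (fst (snd w)) + indicator A (snd (snd w)))) \<in> borel_measurable ?V"
      by measurable
    have "emeasure (fst (?T w)) A - (indicator A (fst (snd w)) + indicator A (snd (snd w))) = emeasure (fst w) A"
      if "w \<in> space ?V" for w
      using that A
      by (auto simp: space_pair_measure space_N case_prod_beta' emeasure_plus_dirac sets_counting_measure add.assoc
          intro!: ennreal_add_diff_cancel_right split: split_indicator_asm)
    from measurable_cong[OF this] * show "(\<lambda>w. emeasure (fst w) A) \<in> borel_measurable ?V"
      by (rule iffD1)
  qed (auto simp: space_pair_measure space_N)
  then have "(\<lambda>w. (fst w, snd w)) \<in> ?V \<rightarrow>\<^sub>M ?W" by measurable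
  then have "(\<lambda>w. (fst w, snd w)) -` S \<inter> space ?V \<in> sets ?V"
    using assms by (rule measurable_sets)
  then have "S \<in> sets ?V"
    using sets.sets_into_space[OF assms] by (simp add: Int_absorb2)
  then obtain E where "E \<in> sets ?W" "S = ?T -` E \<inter> space ?W"
    using measurable_space[OF T] by (subst (asm) sets_vimage_algebra2) auto
  then show ?thesis
    by (intro bexI[of _ E]) (auto simp: space_pair_measure)
qed

end

section \<open>The law of a Gibbs process\<close>

text \<open>
  The Gibbs property involves the process only through its law \<open>D\<close>, so it is stated for measures
  \<open>D\<close> on the space of counting measures; \<open>GNZ\<close> is its defining equation, named after Georgii,
  Nguyen and Zessin.
\<close>

locale gibbs_law = localized_space X B for X :: "'a measure" and B :: "nat \<Rightarrow> 'a set" +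
  fixes \<Lambda> :: "'a measure" and \<kappa> :: "'a \<Rightarrow> 'a measure \<Rightarrow> real" and D :: "'a measure measure"
  assumes loc_fin: "locally_finite_measure X B \<Lambda>"
    and measurable_kappa': "(\<lambda>(x, \<mu>). \<kappa> x \<mu>) \<in> borel_measurable (X \<Otimes>\<^sub>M N)"
    and kappa_nonneg: "x \<in> space X \<Longrightarrow> \<mu> \<in> counting_measures X B \<Longrightarrow> 0 \<le> \<kappa> x \<mu>"
    and diagonal: "measurable_diagonal X"
    and sets_D: "sets D = sets N"
    and sigma_finite_D: "sigma_finite_measure D"
    and GNZ: "(\<lambda>(x, \<mu>). f x \<mu>) \<in> borel_measurable (X \<Otimes>\<^sub>M N) \<Longrightarrow>
      (\<integral>\<^sup>+\<mu>. \<integral>\<^sup>+x. f x \<mu> \<partial>\<mu> \<partial>D) =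
      (\<integral>\<^sup>+\<mu>. \<integral>\<^sup>+x. f x (add_point \<mu> x) * ennreal (\<kappa> x \<mu>) \<partial>\<Lambda> \<partial>D)"

sublocale gibbs_law \<subseteq> L: sigma_finite_measure \<Lambda>
  by (rule sigma_finite_locally_finite[OF loc_fin])

sublocale gibbs_law \<subseteq> DD: sigma_finite_measure D
  by (rule sigma_finite_D)

sublocale gibbs_law \<subseteq> LL: pair_sigma_finite \<Lambda> \<Lambda> ..

sublocale gibbs_law \<subseteq> PL: product_sigma_finite "\<lambda>_::nat. \<Lambda>" ..

context gibbs_law
begin

lemma sets_Lambda [measurable_cong]: "sets \<Lambda> = sets X"
  using loc_fin by (simp add: locally_finite_measure_def)

lemma space_Lambda: "space \<Lambda> = space X"
  using sets_Lambda by (rule sets_eq_imp_space_eq)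

lemmas [measurable_cong] = sets_D

lemma space_D: "space D = counting_measures X B"
  using sets_eq_imp_space_eq[OF sets_D] by (simp add: space_N)

lemma measurable_kappa [measurable (raw)]:
  assumes "f \<in> W \<rightarrow>\<^sub>M X" "g \<in> W \<rightarrow>\<^sub>M N"
  shows "(\<lambda>w. \<kappa> (f w) (g w)) \<in> borel_measurable W"
  using measurable_compose[OF measurable_Pair[OF assms] measurable_kappa'] by simp

lemma measurable_neq [measurable]: "Measurable.pred (X \<Otimes>\<^sub>M X) (\<lambda>(y, x). y \<noteq> x)"
proof -
  have "space (X \<Otimes>\<^sub>M X) - {(x, x) | x. x \<in> space X} \<in> sets (X \<Otimes>\<^sub>M X)"
    using diagonal unfolding measurable_diagonal_def by (rule sets.compl_sets)
  also have "space (X \<Otimes>\<^sub>M X) - {(x, x) | x. x \<in> space X} = {w \<in> space (X \<Otimes>\<^sub>M X). case w of (y, x) \<Rightarrow> y \<noteq> x}"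
    by (auto simp: space_pair_measure)
  finally show ?thesis
    by (simp add: pred_def)
qed

text \<open>
  The Gibbs equation is used first for the point \<open>y\<close>, which turns the outer integral on the left
  into one against \<open>\<mu>(dy)\<close>, and after exchanging the order of integration for the point \<open>x\<close>. In
  between, the integral of \<open>g (\<mu> + \<delta>\<^sub>x) y x\<close> is taken against \<open>\<mu>(dy)\<close> rather than
  \<open>(\<mu> + \<delta>\<^sub>x)(dy)\<close>; the two agree because \<open>g\<close> vanishes on the diagonal.
\<close>

lemma second_order_GNZ:
  assumes g: "(\<lambda>(\<mu>, y, x). g \<mu> y x) \<in> borel_measurable (N \<Otimes>\<^sub>M (X \<Otimes>\<^sub>M X))"
    and diag: "\<And>\<mu> x. \<mu> \<in> space N \<Longrightarrow> x \<in> space X \<Longrightarrow> g \<mu> x x = 0"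
  shows "(\<integral>\<^sup>+\<mu>. \<integral>\<^sup>+y. \<integral>\<^sup>+x. g (add_point (add_point \<mu> y) x) y x *
            ennreal (\<kappa> x (add_point \<mu> y)) * ennreal (\<kappa> y \<mu>) \<partial>\<Lambda> \<partial>\<Lambda> \<partial>D) =
         (\<integral>\<^sup>+\<mu>. \<integral>\<^sup>+x. \<integral>\<^sup>+y. g \<mu> y x \<partial>\<mu> \<partial>\<mu> \<partial>D)"
proof -
  have g' [measurable (raw)]: "(\<lambda>w. g (a w) (b w) (c w)) \<in> borel_measurable W"
    if "a \<in> W \<rightarrow>\<^sub>M N" "b \<in> W \<rightarrow>\<^sub>M X" "c \<in> W \<rightarrow>\<^sub>M X" for a b c and W :: "'c measure"
    using measurable_compose[OF measurable_Pair[OF that(1) measurable_Pair[OF that(2,3)]] g] by simp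
  define F where "F y \<mu> = (\<integral>\<^sup>+x. g (add_point \<mu> x) y x * ennreal (\<kappa> x \<mu>) \<partial>\<Lambda>)" for y \<mu>
  define G where "G x \<mu> = (\<integral>\<^sup>+y. g \<mu> y x \<partial>\<mu>)" for x \<mu>
  have F: "(\<lambda>(y, \<mu>). F y \<mu>) \<in> borel_measurable (X \<Otimes>\<^sub>M N)"
    unfolding F_def case_prod_beta' by measurable
  have G: "(\<lambda>(x, \<mu>). G x \<mu>) \<in> borel_measurable (X \<Otimes>\<^sub>M N)"
    unfolding G_def case_prod_beta' by (intro measurable_nn_integral_counting) measurable
  have "(\<integral>\<^sup>+x. g (add_point (add_point \<mu> y) x) y x * ennreal (\<kappa> x (add_point \<mu> y)) * ennreal (\<kappa> y \<mu>) \<partial>\<Lambda>)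
      = F y (add_point \<mu> y) * ennreal (\<kappa> y \<mu>)"
    if [measurable]: "\<mu> \<in> space N" "y \<in> space X" for \<mu> y
    unfolding F_def using add_point_counting[of \<mu> y] that(1)
    by (subst nn_integral_multc) (auto simp: space_N)
  then have "(\<integral>\<^sup>+\<mu>. \<integral>\<^sup>+y. \<integral>\<^sup>+x. g (add_point (add_point \<mu> y) x) y x *
            ennreal (\<kappa> x (add_point \<mu> y)) * ennreal (\<kappa> y \<mu>) \<partial>\<Lambda> \<partial>\<Lambda> \<partial>D)
      = (\<integral>\<^sup>+\<mu>. \<integral>\<^sup>+y. F y (add_point \<mu> y) * ennreal (\<kappa> y \<mu>) \<partial>\<Lambda> \<partial>D)"
    by (intro nn_integral_cong) (auto simp: space_D space_N space_Lambda)
  also have "\<dots> = (\<integral>\<^sup>+\<mu>. \<integral>\<^sup>+y. F y \<mu> \<partial>\<mu> \<partial>D)"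
    by (rule GNZ[OF F, symmetric])
  also have "\<dots> = (\<integral>\<^sup>+\<mu>. \<integral>\<^sup>+x. G x (add_point \<mu> x) * ennreal (\<kappa> x \<mu>) \<partial>\<Lambda> \<partial>D)"
  proof (rule nn_integral_cong)
    fix \<mu> assume "\<mu> \<in> space D"
    then have \<mu>: "\<mu> \<in> counting_measures X B" and [measurable]: "\<mu> \<in> space N"
      by (auto simp: space_D space_N)
    note [measurable_cong] = sets_counting_measure[OF \<mu>]
    interpret M: sigma_finite_measure \<mu>
      by (rule sigma_finite_counting[OF \<mu>])
    interpret prod: pair_sigma_finite \<mu> \<Lambda> ..
    have "(\<integral>\<^sup>+y. F y \<mu> \<partial>\<mu>) = (\<integral>\<^sup>+x. \<integral>\<^sup>+y. g (add_point \<mu> x) y x * ennreal (\<kappa> x \<mu>) \<partial>\<mu> \<partial>\<Lambda>)"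
      unfolding F_def
      by (intro prod.Fubini'[symmetric]) measurable
    also have "\<dots> = (\<integral>\<^sup>+x. G x (add_point \<mu> x) * ennreal (\<kappa> x \<mu>) \<partial>\<Lambda>)"
    proof (rule nn_integral_cong)
      fix x assume "x \<in> space \<Lambda>"
      then have x [measurable]: "x \<in> space X" by (simp add: space_Lambda)
      have \<mu>x: "add_point \<mu> x \<in> space N"
        using add_point_counting[OF \<mu>] by (simp add: space_N)
      have g1: "(\<lambda>y. g (add_point \<mu> x) y x) \<in> borel_measurable X"
        using \<mu>x x by (intro g') auto
      have "(\<integral>\<^sup>+y. g (add_point \<mu> x) y x \<partial>\<mu>) = G x (add_point \<mu> x)"
        using diag[OF \<mu>x x] x unfolding G_def
        by (subst nn_integral_plus_dirac[OF sets_counting_measure[OF \<mu>] x g1]) simp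
      then show "(\<integral>\<^sup>+y. g (add_point \<mu> x) y x * ennreal (\<kappa> x \<mu>) \<partial>\<mu>) = G x (add_point \<mu> x) * ennreal (\<kappa> x \<mu>)"
        using g1 by (subst nn_integral_multc) (auto simp: measurable_cong_sets[OF sets_counting_measure[OF \<mu>] refl])
    qed
    finally show "(\<integral>\<^sup>+y. F y \<mu> \<partial>\<mu>) = (\<integral>\<^sup>+x. G x (add_point \<mu> x) * ennreal (\<kappa> x \<mu>) \<partial>\<Lambda>)" .
  qed
  also have "\<dots> = (\<integral>\<^sup>+\<mu>. \<integral>\<^sup>+x. G x \<mu> \<partial>\<mu> \<partial>D)"
    by (rule GNZ[OF G, symmetric])
  finally show ?thesis by (simp add: G_def)
qed

text \<open>
  The two sides, set to zero on the diagonal, are denoted by \<open>a\<close> and \<open>b\<close>. A test set \<open>S\<close> is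
  expressed through the configuration \<open>\<mu> + \<delta>\<^sub>y + \<delta>\<^sub>x\<close>; then \<open>second_order_GNZ\<close> rewrites
  both integrals over \<open>S\<close> as integrals against \<open>\<mu> \<otimes> \<mu>\<close> that differ by exchanging the two points.
\<close>

lemma AE_two_points_commute:
  "AE \<mu> in D. AE y in \<Lambda>. AE x in \<Lambda>. \<kappa> x (add_point \<mu> y) * \<kappa> y \<mu> = \<kappa> y (add_point \<mu> x) * \<kappa> x \<mu>"
proof -
  interpret P: pair_sigma_finite D "\<Lambda> \<Otimes>\<^sub>M \<Lambda>" ..
  let ?\<nu> = "D \<Otimes>\<^sub>M (\<Lambda> \<Otimes>\<^sub>M \<Lambda>)"
  define r where "r \<mu> y x = ennreal (\<kappa> x (add_point \<mu> y)) * ennreal (\<kappa> y \<mu>)" for \<mu> y x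
  define a where "a = (\<lambda>(\<mu>, y, x). if y \<noteq> x then r \<mu> y x else 0)"
  define b where "b = (\<lambda>(\<mu>, y, x). if y \<noteq> x then r \<mu> x y else 0)"
  have neq [measurable]: "Measurable.pred W (\<lambda>w. f w \<noteq> g w)"
    if "f \<in> W \<rightarrow>\<^sub>M X" "g \<in> W \<rightarrow>\<^sub>M X" for f g and W :: "'c measure"
    using measurable_compose[OF measurable_Pair[OF that] measurable_neq] by simp
  have a [measurable]: "a \<in> borel_measurable ?\<nu>" and b [measurable]: "b \<in> borel_measurable ?\<nu>"
    unfolding a_def b_def r_def case_prod_beta' by measurable
  have iterated: "integral\<^sup>N ?\<nu> f = (\<integral>\<^sup>+\<mu>. \<integral>\<^sup>+y. \<integral>\<^sup>+x. f (\<mu>, y, x) \<partial>\<Lambda> \<partial>\<Lambda> \<partial>D)"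
    if f: "f \<in> borel_measurable ?\<nu>" for f
  proof -
    have "integral\<^sup>N ?\<nu> f = (\<integral>\<^sup>+\<mu>. \<integral>\<^sup>+w. f (\<mu>, w) \<partial>(\<Lambda> \<Otimes>\<^sub>M \<Lambda>) \<partial>D)"
      by (rule LL.P.nn_integral_fst[OF f, symmetric])
    also have "\<dots> = (\<integral>\<^sup>+\<mu>. \<integral>\<^sup>+y. \<integral>\<^sup>+x. f (\<mu>, y, x) \<partial>\<Lambda> \<partial>\<Lambda> \<partial>D)"
      using measurable_Pair2[OF f] by (intro nn_integral_cong L.nn_integral_fst[symmetric])
    finally show ?thesis .
  qed
  have "density ?\<nu> a = density ?\<nu> b"
  proof (rule measure_eqI)
    fix S assume "S \<in> sets (density ?\<nu> a)"
    then have S [measurable]: "S \<in> sets ?\<nu>" by simp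
    moreover have "sets ?\<nu> = sets (N \<Otimes>\<^sub>M (X \<Otimes>\<^sub>M X))"
      by (intro sets_pair_measure_cong sets_D sets_Lambda)
    ultimately obtain E where E [measurable]: "E \<in> sets (N \<Otimes>\<^sub>M (X \<Otimes>\<^sub>M X))"
      and SE: "\<And>\<mu> y x. \<mu> \<in> space N \<Longrightarrow> y \<in> space X \<Longrightarrow> x \<in> space X \<Longrightarrow>
        (\<mu>, y, x) \<in> S \<longleftrightarrow> (add_point (add_point \<mu> y) x, y, x) \<in> E"
      using sets_add_two_points[of S] by auto
    define h where "h \<mu> y x = (if y \<noteq> x then indicator E (\<mu>, y, x) else 0 :: ennreal)" for \<mu> y x
    have h: "(\<lambda>(\<mu>, y, x). h \<mu> y x) \<in> borel_measurable (N \<Otimes>\<^sub>M (X \<Otimes>\<^sub>M X))"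
      and h': "(\<lambda>(\<mu>, y, x). h \<mu> x y) \<in> borel_measurable (N \<Otimes>\<^sub>M (X \<Otimes>\<^sub>M X))"
      unfolding h_def case_prod_beta' by measurable
    have "emeasure (density ?\<nu> a) S = (\<integral>\<^sup>+\<mu>. \<integral>\<^sup>+y. \<integral>\<^sup>+x. a (\<mu>, y, x) * indicator S (\<mu>, y, x) \<partial>\<Lambda> \<partial>\<Lambda> \<partial>D)"
      by (simp add: emeasure_density iterated)
    also have "\<dots> = (\<integral>\<^sup>+\<mu>. \<integral>\<^sup>+y. \<integral>\<^sup>+x. h (add_point (add_point \<mu> y) x) y x *
            ennreal (\<kappa> x (add_point \<mu> y)) * ennreal (\<kappa> y \<mu>) \<partial>\<Lambda> \<partial>\<Lambda> \<partial>D)"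
      by (intro nn_integral_cong)
        (auto simp: space_D space_N[symmetric] space_Lambda a_def h_def r_def SE split: split_indicator)
    also have "\<dots> = (\<integral>\<^sup>+\<mu>. \<integral>\<^sup>+x. \<integral>\<^sup>+y. h \<mu> y x \<partial>\<mu> \<partial>\<mu> \<partial>D)"
      using h by (rule second_order_GNZ) (simp add: h_def)
    also have "\<dots> = (\<integral>\<^sup>+\<mu>. \<integral>\<^sup>+x. \<integral>\<^sup>+y. h \<mu> x y \<partial>\<mu> \<partial>\<mu> \<partial>D)"
    proof (rule nn_integral_cong)
      fix \<mu> assume "\<mu> \<in> space D"
      then have \<mu>: "\<mu> \<in> counting_measures X B" "\<mu> \<in> space N"
        by (auto simp: space_D space_N)
      interpret M: sigma_finite_measure \<mu>
        by (rule sigma_finite_counting[OF \<mu>(1)])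
      interpret MM: pair_sigma_finite \<mu> \<mu> ..
      have "case_prod (h \<mu>) \<in> borel_measurable (\<mu> \<Otimes>\<^sub>M \<mu>)"
        using measurable_Pair2[OF h \<mu>(2)]
        by (simp add: case_prod_beta' measurable_cong_sets[OF sets_pair_measure_cong[OF sets_counting_measure sets_counting_measure, OF \<mu>(1) \<mu>(1)] refl])
      from MM.Fubini'[OF this] show "(\<integral>\<^sup>+x. \<integral>\<^sup>+y. h \<mu> y x \<partial>\<mu> \<partial>\<mu>) = (\<integral>\<^sup>+x. \<integral>\<^sup>+y. h \<mu> x y \<partial>\<mu> \<partial>\<mu>)" .
    qed
    also have "\<dots> = (\<integral>\<^sup>+\<mu>. \<integral>\<^sup>+y. \<integral>\<^sup>+x. h (add_point (add_point \<mu> y) x) x y *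
            ennreal (\<kappa> x (add_point \<mu> y)) * ennreal (\<kappa> y \<mu>) \<partial>\<Lambda> \<partial>\<Lambda> \<partial>D)"
      using h' by (rule second_order_GNZ[symmetric]) (simp add: h_def)
    also have "\<dots> = (\<integral>\<^sup>+\<mu>. \<integral>\<^sup>+y. \<integral>\<^sup>+x. b (\<mu>, x, y) * indicator S (\<mu>, x, y) \<partial>\<Lambda> \<partial>\<Lambda> \<partial>D)"
    proof (intro nn_integral_cong)
      fix \<mu> y x assume "\<mu> \<in> space D" "y \<in> space \<Lambda>" "x \<in> space \<Lambda>"
      then have \<mu>: "\<mu> \<in> counting_measures X B" and "y \<in> space X" "x \<in> space X"
        by (auto simp: space_D space_Lambda)
      moreover have "add_point (add_point \<mu> y) x = add_point (add_point \<mu> x) y"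
        by (rule plus_dirac_commute[OF sets_counting_measure[OF \<mu>]])
      ultimately show "h (add_point (add_point \<mu> y) x) x y * ennreal (\<kappa> x (add_point \<mu> y)) * ennreal (\<kappa> y \<mu>) =
          b (\<mu>, x, y) * indicator S (\<mu>, x, y)"
        using SE[of \<mu> x y] by (simp add: b_def h_def r_def space_N split: split_indicator)
    qed
    also have "\<dots> = (\<integral>\<^sup>+\<mu>. \<integral>\<^sup>+x. \<integral>\<^sup>+y. b (\<mu>, x, y) * indicator S (\<mu>, x, y) \<partial>\<Lambda> \<partial>\<Lambda> \<partial>D)"
    proof (rule nn_integral_cong)
      fix \<mu> assume [measurable]: "\<mu> \<in> space D"
      show "(\<integral>\<^sup>+y. \<integral>\<^sup>+x. b (\<mu>, x, y) * indicator S (\<mu>, x, y) \<partial>\<Lambda> \<partial>\<Lambda>) =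
        (\<integral>\<^sup>+x. \<integral>\<^sup>+y. b (\<mu>, x, y) * indicator S (\<mu>, x, y) \<partial>\<Lambda> \<partial>\<Lambda>)"
        by (rule LL.Fubini') measurable
    qed
    also have "\<dots> = emeasure (density ?\<nu> b) S"
      by (simp add: emeasure_density iterated)
    finally show "emeasure (density ?\<nu> a) S = emeasure (density ?\<nu> b) S" .
  qed simp
  from P.AE_pair[OF P.P.density_unique[OF a b this]] show ?thesis
    using AE_space
  proof eventually_elim
    fix \<mu> assume "AE w in \<Lambda> \<Otimes>\<^sub>M \<Lambda>. a (\<mu>, w) = b (\<mu>, w)" and "\<mu> \<in> space D"
    then have ae: "AE y in \<Lambda>. AE x in \<Lambda>. a (\<mu>, y, x) = b (\<mu>, y, x)" and \<mu>: "\<mu> \<in> counting_measures X B"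
      by (auto dest: LL.AE_pair simp: space_D)
    from ae AE_space show "AE y in \<Lambda>. AE x in \<Lambda>. \<kappa> x (add_point \<mu> y) * \<kappa> y \<mu> = \<kappa> y (add_point \<mu> x) * \<kappa> x \<mu>"
    proof eventually_elim
      case (elim y)
      from elim(1) AE_space show ?case
      proof eventually_elim
        fix x assume "a (\<mu>, y, x) = b (\<mu>, y, x)" and x: "x \<in> space \<Lambda>"
        then have "r \<mu> y x = r \<mu> x y"
          by (auto simp: a_def b_def split: if_splits)
        then show "\<kappa> x (add_point \<mu> y) * \<kappa> y \<mu> = \<kappa> y (add_point \<mu> x) * \<kappa> x \<mu>"
          using x elim(2) \<mu> unfolding r_def space_Lambda
          by (simp add: ennreal_mult[symmetric] kappa_nonneg add_point_counting)
      qed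
    qed
  qed
qed

text \<open>
  For a \<open>D\<close>-null set \<open>S\<close>, the Gibbs equation with the function \<open>1\<^sub>S(\<mu>)\<close> has left-hand side zero, so
  the integral of \<open>1\<^sub>S(\<mu> + \<delta>\<^sub>x) \<kappa> x \<mu>\<close> vanishes.
\<close>

lemma AE_add_point:
  assumes "AE \<mu> in D. P \<mu>"
  shows "AE \<mu> in D. AE x in \<Lambda>. \<kappa> x \<mu> = 0 \<or> P (add_point \<mu> x)"
proof -
  obtain S where S: "{\<mu> \<in> space D. \<not> P \<mu>} \<subseteq> S" "emeasure D S = 0" "S \<in> sets D"
    using assms by (rule AE_E)
  have [measurable]: "S \<in> sets N" using S(3) sets_D by simp
  have "AE \<mu> in D. \<mu> \<notin> S"
    using S by (intro AE_not_in) auto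
  then have "(\<integral>\<^sup>+\<mu>. \<integral>\<^sup>+x. indicator S \<mu> \<partial>\<mu> \<partial>D) = (\<integral>\<^sup>+\<mu>. 0 \<partial>D)"
    by (intro nn_integral_cong_AE) auto
  then have 0: "(\<integral>\<^sup>+\<mu>. \<integral>\<^sup>+x. indicator S (add_point \<mu> x) * ennreal (\<kappa> x \<mu>) \<partial>\<Lambda> \<partial>D) = 0"
    by (subst GNZ[of "\<lambda>_. indicator S", symmetric]) auto
  have "(\<lambda>\<mu>. \<integral>\<^sup>+x. indicator S (add_point \<mu> x) * ennreal (\<kappa> x \<mu>) \<partial>\<Lambda>) \<in> borel_measurable D"
    by measurable
  with 0 have "AE \<mu> in D. (\<integral>\<^sup>+x. indicator S (add_point \<mu> x) * ennreal (\<kappa> x \<mu>) \<partial>\<Lambda>) = 0"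
    by (simp add: nn_integral_0_iff_AE)
  then show ?thesis
    using AE_space
  proof eventually_elim
    case (elim \<mu>)
    have [measurable]: "\<mu> \<in> space N" using elim(2) by (simp add: space_D space_N)
    have "(\<lambda>x. indicator S (add_point \<mu> x) * ennreal (\<kappa> x \<mu>)) \<in> borel_measurable \<Lambda>"
      by measurable
    with elim(1) have "AE x in \<Lambda>. indicator S (add_point \<mu> x) * ennreal (\<kappa> x \<mu>) = 0"
      by (simp add: nn_integral_0_iff_AE)
    then show ?case
      using AE_space
    proof eventually_elim
      case (elim x)
      then show ?case
        using \<open>\<mu> \<in> space D\<close> S(1) kappa_nonneg[of x \<mu>] add_point_counting[of \<mu> x]
        by (auto simp: space_D space_Lambda indicator_eq_0_iff ennreal_eq_0_iff)
    qed
  qed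
qed

section \<open>Symmetry of the iterated intensities\<close>

lemma kappa_iter_Suc:
  assumes "\<mu> \<in> counting_measures X B"
  shows "kappa_iter X \<kappa> (Suc m) x \<mu> = kappa_iter X \<kappa> m x (add_point \<mu> (x (Suc m))) * \<kappa> (x (Suc m)) \<mu>"
proof -
  have "plus_measure \<mu> (dirac_sum X {i<..Suc m} x) =
      plus_measure (add_point \<mu> (x (Suc m))) (dirac_sum X {i<..m} x)" if "i \<le> m" for i
  proof -
    have "{i<..Suc m} = insert (Suc m) {i<..m}" using that by auto
    then show ?thesis
      using sets_counting_measure[OF assms]
      by (intro measure_eqI) (auto simp: emeasure_plus_dirac_sum emeasure_plus_dirac ac_simps)
  qed
  moreover have "plus_measure \<mu> (dirac_sum X {} x) = \<mu>"
    using sets_counting_measure[OF assms] by (intro measure_eqI) (auto simp: emeasure_plus_dirac_sum)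
  ultimately show ?thesis
    by (simp add: kappa_iter_def)
qed

lemma kappa_iter_cong:
  assumes "\<And>i. i \<in> {1..m} \<Longrightarrow> x i = y i"
  shows "kappa_iter X \<kappa> m x \<mu> = kappa_iter X \<kappa> m y \<mu>"
proof -
  have "dirac_sum X {i<..m} x = dirac_sum X {i<..m} y" for i
    using assms by (intro measure_eqI) (auto simp: emeasure_dirac_sum intro!: sum.cong)
  then show ?thesis
    using assms by (simp add: kappa_iter_def)
qed

lemma measurable_kappa_iter:
  assumes f: "f \<in> W \<rightarrow>\<^sub>M N" and g: "\<And>i. i \<in> {1..m} \<Longrightarrow> (\<lambda>w. g w i) \<in> W \<rightarrow>\<^sub>M X"
  shows "(\<lambda>w. kappa_iter X \<kappa> m (g w) (f w)) \<in> borel_measurable W"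
  unfolding kappa_iter_def using f g
  by (intro borel_measurable_prod measurable_kappa measurable_plus_dirac_sum) auto

lemma measurable_kappa_iter_permute:
  assumes f: "f \<in> W \<rightarrow>\<^sub>M N" and g: "g \<in> W \<rightarrow>\<^sub>M (\<Pi>\<^sub>M i\<in>{1..m}. \<Lambda>)" and "\<tau> permutes {1..m}"
  shows "(\<lambda>w. kappa_iter X \<kappa> m (\<lambda>i. g w (\<tau> i)) (f w)) \<in> borel_measurable W"
proof (rule measurable_kappa_iter[OF f])
  fix i assume "i \<in> {1..m}"
  then have [measurable]: "\<tau> i \<in> {1..m}" using permutes_in_image[OF assms(3)] by blast
  note [measurable] = g
  have "(\<lambda>w. g w (\<tau> i)) \<in> W \<rightarrow>\<^sub>M \<Lambda>" by measurable
  then show "(\<lambda>w. g w (\<tau> i)) \<in> W \<rightarrow>\<^sub>M X"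
    by (simp add: measurable_cong_sets[OF refl sets_Lambda])
qed

definition invariant :: "nat \<Rightarrow> 'a measure \<Rightarrow> (nat \<Rightarrow> nat) \<Rightarrow> bool" where
  "invariant m \<mu> \<tau> \<longleftrightarrow>
     (AE x in \<Pi>\<^sub>M i\<in>{1..m}. \<Lambda>. kappa_iter X \<kappa> m x \<mu> = kappa_iter X \<kappa> m (\<lambda>i. x (\<tau> i)) \<mu>)"

lemma invariant_comp:
  assumes "\<sigma> permutes {1..m}" "invariant m \<mu> \<sigma>" "invariant m \<mu> \<tau>"
  shows "invariant m \<mu> (\<sigma> \<circ> \<tau>)"
proof -
  have "AE x in \<Pi>\<^sub>M i\<in>{1..m}. \<Lambda>. kappa_iter X \<kappa> m (x \<circ> \<sigma>) \<mu> = kappa_iter X \<kappa> m (\<lambda>i. (x \<circ> \<sigma>) (\<tau> i)) \<mu>"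
    using assms(3) unfolding invariant_def
    by (intro AE_PiM_permute[OF sigma_finite_locally_finite[OF loc_fin] _ assms(1)]) auto
  then show ?thesis
    using assms(2) unfolding invariant_def by eventually_elim (simp add: o_def)
qed

lemma invariant_SucI:
  assumes \<mu>: "\<mu> \<in> counting_measures X B" and \<tau>: "\<tau> permutes {1..Suc m}"
    and "AE y in \<Lambda>. AE x in \<Pi>\<^sub>M i\<in>{1..m}. \<Lambda>. kappa_iter X \<kappa> (Suc m) (x(Suc m := y)) \<mu> =
       kappa_iter X \<kappa> (Suc m) (\<lambda>i. (x(Suc m := y)) (\<tau> i)) \<mu>"
  shows "invariant (Suc m) \<mu> \<tau>"
proof -
  have *: "{1..Suc m} = insert (Suc m) {1..m}" by auto
  have [measurable]: "\<mu> \<in> space N" using \<mu> by (simp add: space_N)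
  have [measurable]: "(\<lambda>x. kappa_iter X \<kappa> (Suc m) x \<mu>) \<in> borel_measurable (\<Pi>\<^sub>M i\<in>{1..Suc m}. \<Lambda>)"
      "(\<lambda>x. kappa_iter X \<kappa> (Suc m) (\<lambda>i. x (\<tau> i)) \<mu>) \<in> borel_measurable (\<Pi>\<^sub>M i\<in>{1..Suc m}. \<Lambda>)"
    using measurable_kappa_iter_permute[OF _ measurable_ident permutes_id, of "\<lambda>_. \<mu>"]
      measurable_kappa_iter_permute[OF _ measurable_ident \<tau>, of "\<lambda>_. \<mu>"] by auto
  have "{x \<in> space (\<Pi>\<^sub>M i\<in>{1..Suc m}. \<Lambda>). kappa_iter X \<kappa> (Suc m) x \<mu> = kappa_iter X \<kappa> (Suc m) (\<lambda>i. x (\<tau> i)) \<mu>}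
    \<in> sets (\<Pi>\<^sub>M i\<in>{1..Suc m}. \<Lambda>)"
    by measurable
  then show ?thesis
    unfolding invariant_def * using assms(3) by (intro PL.AE_PiM_insert) auto
qed

text \<open>
  The common factor \<open>\<kappa> y \<mu>\<close> belonging to the last point \<open>y\<close> makes up for the points \<open>y\<close> at which
  invariance of the remaining factors fails.
\<close>

lemma invariant_fix_last:
  assumes \<mu>: "\<mu> \<in> counting_measures X B" and \<tau>: "\<tau> permutes {1..m}"
    and ae: "AE y in \<Lambda>. \<kappa> y \<mu> = 0 \<or> invariant m (add_point \<mu> y) \<tau>"
  shows "invariant (Suc m) \<mu> \<tau>"
proof (rule invariant_SucI[OF \<mu>])
  show "\<tau> permutes {1..Suc m}"
    using \<tau> by (rule permutes_subset) auto
  have \<tau>i: "\<tau> i \<noteq> Suc m" if "i \<in> {1..m}" for i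
    using permutes_in_image[OF \<tau>, of i] that by auto
  have \<tau>S: "\<tau> (Suc m) = Suc m"
    using permutes_not_in[OF \<tau>] by auto
  have 1: "kappa_iter X \<kappa> (Suc m) (x(Suc m := y)) \<mu> = kappa_iter X \<kappa> m x (add_point \<mu> y) * \<kappa> y \<mu>" for x y
    unfolding kappa_iter_Suc[OF \<mu>] using kappa_iter_cong[of m "x(Suc m := y)" x] by simp
  have 2: "kappa_iter X \<kappa> (Suc m) (\<lambda>i. (x(Suc m := y)) (\<tau> i)) \<mu> =
      kappa_iter X \<kappa> m (\<lambda>i. x (\<tau> i)) (add_point \<mu> y) * \<kappa> y \<mu>" for x y
    unfolding kappa_iter_Suc[OF \<mu>]
    using kappa_iter_cong[of m "\<lambda>i. (x(Suc m := y)) (\<tau> i)" "\<lambda>i. x (\<tau> i)"] \<tau>i by (simp add: \<tau>S)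
  show "AE y in \<Lambda>. AE x in \<Pi>\<^sub>M i\<in>{1..m}. \<Lambda>. kappa_iter X \<kappa> (Suc m) (x(Suc m := y)) \<mu> =
       kappa_iter X \<kappa> (Suc m) (\<lambda>i. (x(Suc m := y)) (\<tau> i)) \<mu>"
    unfolding 1 2 using ae by eventually_elim (auto simp: invariant_def)
qed

text \<open>
  The last two points \<open>x\<close>, \<open>y\<close> enter the remaining factors only through \<open>\<mu> + \<delta>\<^sub>y + \<delta>\<^sub>x\<close>, so only
  the product of the two factors belonging to them has to be symmetric.
\<close>

lemma invariant_swap_last:
  assumes \<mu>: "\<mu> \<in> counting_measures X B"
    and ae: "AE y in \<Lambda>. AE x in \<Lambda>. \<kappa> x (add_point \<mu> y) * \<kappa> y \<mu> = \<kappa> y (add_point \<mu> x) * \<kappa> x \<mu>"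
  shows "invariant (Suc (Suc k)) \<mu> (Transposition.transpose (Suc k) (Suc (Suc k)))"
proof (rule invariant_SucI[OF \<mu>])
  let ?t = "Transposition.transpose (Suc k) (Suc (Suc k))"
  show t: "?t permutes {1..Suc (Suc k)}" by (rule permutes_swap_id) auto
  have *: "{1..Suc k} = insert (Suc k) {1..k}" by auto
  show "AE y in \<Lambda>. AE x in \<Pi>\<^sub>M i\<in>{1..Suc k}. \<Lambda>. kappa_iter X \<kappa> (Suc (Suc k)) (x(Suc (Suc k) := y)) \<mu> =
       kappa_iter X \<kappa> (Suc (Suc k)) (\<lambda>i. (x(Suc (Suc k) := y)) (?t i)) \<mu>"
    using ae AE_space
  proof eventually_elim
    case (elim y)
    have y: "y \<in> space X" using elim(2) by (simp add: space_Lambda)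
    have [measurable]: "\<mu> \<in> space N" using \<mu> by (simp add: space_N)
    have upd: "(\<lambda>x. x(Suc (Suc k) := y)) \<in> (\<Pi>\<^sub>M i\<in>{1..Suc k}. \<Lambda>) \<rightarrow>\<^sub>M (\<Pi>\<^sub>M i\<in>{1..Suc (Suc k)}. \<Lambda>)"
      using elim(2) by (intro measurable_fun_upd[where J="{1..Suc k}"]) auto
    have [measurable]: "(\<lambda>x. kappa_iter X \<kappa> (Suc (Suc k)) (x(Suc (Suc k) := y)) \<mu>) \<in> borel_measurable (\<Pi>\<^sub>M i\<in>{1..Suc k}. \<Lambda>)"
      "(\<lambda>x. kappa_iter X \<kappa> (Suc (Suc k)) (\<lambda>i. (x(Suc (Suc k) := y)) (?t i)) \<mu>) \<in> borel_measurable (\<Pi>\<^sub>M i\<in>{1..Suc k}. \<Lambda>)"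
      using measurable_kappa_iter_permute[OF _ upd permutes_id, of "\<lambda>_. \<mu>"]
        measurable_kappa_iter_permute[OF _ upd t, of "\<lambda>_. \<mu>"] by (auto simp: fun_upd_def)
    have meas: "{x \<in> space (\<Pi>\<^sub>M i\<in>{1..Suc k}. \<Lambda>). kappa_iter X \<kappa> (Suc (Suc k)) (x(Suc (Suc k) := y)) \<mu> =
       kappa_iter X \<kappa> (Suc (Suc k)) (\<lambda>i. (x(Suc (Suc k) := y)) (?t i)) \<mu>} \<in> sets (\<Pi>\<^sub>M i\<in>{1..Suc k}. \<Lambda>)"
      by measurable
    have eq: "kappa_iter X \<kappa> (Suc (Suc k)) (z(Suc k := x, Suc (Suc k) := y)) \<mu> =
       kappa_iter X \<kappa> (Suc (Suc k)) (\<lambda>i. (z(Suc k := x, Suc (Suc k) := y)) (?t i)) \<mu>"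
      if "\<kappa> x (add_point \<mu> y) * \<kappa> y \<mu> = \<kappa> y (add_point \<mu> x) * \<kappa> x \<mu>" for x z
    proof -
      have "kappa_iter X \<kappa> (Suc (Suc k)) w \<mu> = kappa_iter X \<kappa> k z (add_point (add_point \<mu> (w (Suc (Suc k)))) (w (Suc k))) *
          (\<kappa> (w (Suc k)) (add_point \<mu> (w (Suc (Suc k)))) * \<kappa> (w (Suc (Suc k))) \<mu>)"
        if "\<And>i. i \<in> {1..k} \<Longrightarrow> w i = z i" for w
        using kappa_iter_cong[of k w z] that by (simp add: kappa_iter_Suc \<mu> add_point_counting)
      note this[of "z(Suc k := x, Suc (Suc k) := y)"] this[of "\<lambda>i. (z(Suc k := x, Suc (Suc k) := y)) (?t i)"]
      then show ?thesis
        using that plus_dirac_commute[OF sets_counting_measure[OF \<mu>], of x y]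
        by (simp add: transpose_def)
    qed
    have "AE x in \<Lambda>. AE z in \<Pi>\<^sub>M i\<in>{1..k}. \<Lambda>. kappa_iter X \<kappa> (Suc (Suc k)) (z(Suc k := x, Suc (Suc k) := y)) \<mu> =
       kappa_iter X \<kappa> (Suc (Suc k)) (\<lambda>i. (z(Suc k := x, Suc (Suc k) := y)) (?t i)) \<mu>"
      using elim(1) by eventually_elim (use eq in auto)
    then show ?case
      using meas unfolding * by (intro PL.AE_PiM_insert) auto
  qed
qed

lemma invariant_permutes:
  assumes "\<And>a b. a \<in> {1..m} \<Longrightarrow> b \<in> {1..m} \<Longrightarrow> a < b \<Longrightarrow> invariant m \<mu> (Transposition.transpose a b)" and "\<tau> permutes {1..m}"
  shows "invariant m \<mu> \<tau>"
  using assms(2) finite_atLeastAtMost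
proof (induction rule: permutes_induct)
  case id
  then show ?case by (simp add: invariant_def)
next
  case (swap a b p)
  have "invariant m \<mu> (Transposition.transpose a b)"
    using swap assms(1)[of a b] assms(1)[of b a] by (cases a b rule: linorder_cases) (auto simp: transpose_commute)
  then show ?case
    using swap by (intro invariant_comp permutes_swap_id) auto
qed

lemma AE_invariant:
  "AE \<mu> in D. \<forall>\<tau>. \<tau> permutes {1..m} \<longrightarrow> invariant m \<mu> \<tau>"
proof (induction m)
  case 0
  then show ?case by (auto simp: invariant_def)
next
  case (Suc m)
  from AE_add_point[OF Suc] AE_two_points_commute AE_space show ?case
  proof eventually_elim
    case (elim \<mu>)
    then have \<mu>: "\<mu> \<in> counting_measures X B" by (simp add: space_D)
    have low: "invariant (Suc m) \<mu> (Transposition.transpose a b)" if "a \<in> {1..m}" "b \<in> {1..m}" for a b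
    proof (rule invariant_fix_last[OF \<mu>])
      show t: "Transposition.transpose a b permutes {1..m}"
        using that by (rule permutes_swap_id)
      show "AE y in \<Lambda>. \<kappa> y \<mu> = 0 \<or> invariant m (add_point \<mu> y) (Transposition.transpose a b)"
        using elim(1) by eventually_elim (use t in auto)
    qed
    have top: "invariant (Suc m) \<mu> (Transposition.transpose m (Suc m))" if "1 \<le> m"
      using invariant_swap_last[OF \<mu> elim(2), of "m - 1"] that by simp
    have "invariant (Suc m) \<mu> (Transposition.transpose a b)"
      if ab: "a \<in> {1..Suc m}" "b \<in> {1..Suc m}" "a < b" for a b
    proof (cases "b = Suc m")
      case False
      with ab show ?thesis by (intro low) auto
    next
      case b: True
      show ?thesis
      proof (cases "a = m")
        case True
        with b ab top show ?thesis by auto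
      next
        case False
        \<comment> \<open>Conjugating by \<open>(a m)\<close> reduces the exchange of \<open>a\<close> and \<open>Suc m\<close> to the two cases above.\<close>
        have "Transposition.transpose a b = Transposition.transpose a m \<circ> Transposition.transpose m (Suc m) \<circ> Transposition.transpose a m"
          using False ab unfolding b by (auto simp: Transposition.transpose_def fun_eq_iff)
        moreover have "invariant (Suc m) \<mu> (Transposition.transpose a m \<circ> Transposition.transpose m (Suc m) \<circ> Transposition.transpose a m)"
          using ab b by (intro invariant_comp low top permutes_compose permutes_swap_id) auto
        ultimately show ?thesis by simp
      qed
    qed
    then show ?case
      by (auto intro: invariant_permutes)
  qed
qed

end

text \<open>
  Almost everywhere statements iterated with \<open>\<mu>\<close> outermost are turned into one on the product
  measure by Tonelli's theorem, which needs the joint measurability of the iterated intensity.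
\<close>

theorem lemma2p3:
  fixes X \<Lambda> :: "'a measure"
    and B :: "nat \<Rightarrow> 'a set"
    and \<kappa> :: "'a \<Rightarrow> 'a measure \<Rightarrow> real"
    and M :: "'w measure"
    and \<eta> :: "'w \<Rightarrow> 'a measure"
    and m :: nat
    and \<tau> :: "nat \<Rightarrow> nat"
  assumes "localizing X B"
    and "locally_finite_measure X B \<Lambda>"
    and "(\<lambda>(x, \<mu>). \<kappa> x \<mu>) \<in> borel_measurable (X \<Otimes>\<^sub>M counting_algebra X B)"
    and "\<And>x \<mu>. x \<in> space X \<Longrightarrow> \<mu> \<in> counting_measures X B \<Longrightarrow> 0 \<le> \<kappa> x \<mu>"
    and "measurable_diagonal X"
    and "gibbs_process M X B \<Lambda> \<kappa> \<eta>"
    and "\<tau> permutes {1..m}"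
  shows "AE (x, \<mu>) in (\<Pi>\<^sub>M i\<in>{1..m}. \<Lambda>) \<Otimes>\<^sub>M distr M (counting_algebra X B) \<eta>.
           kappa_iter X \<kappa> m x \<mu> = kappa_iter X \<kappa> m (\<lambda>i. x (\<tau> i)) \<mu>"
proof -
  let ?D = "distr M (counting_algebra X B) \<eta>"
  have M: "prob_space M" and \<eta> [measurable]: "\<eta> \<in> M \<rightarrow>\<^sub>M counting_algebra X B"
    using assms(6) by (auto simp: gibbs_process_def point_process_def)
  interpret M: prob_space M by (rule M)
  interpret D: prob_space ?D by (rule M.prob_space_distr) measurable
  interpret localized_space X B by standard (rule assms(1))
  interpret L: sigma_finite_measure \<Lambda> by (rule sigma_finite_locally_finite[OF assms(2)])
  have [measurable_cong]: "sets \<Lambda> = sets X"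
    using assms(2) by (simp add: locally_finite_measure_def)
  interpret gibbs_law X B \<Lambda> \<kappa> ?D
  proof
    fix f :: "'a \<Rightarrow> 'a measure \<Rightarrow> ennreal"
    assume f: "(\<lambda>(x, \<mu>). f x \<mu>) \<in> borel_measurable (X \<Otimes>\<^sub>M N)"
    have f' [measurable (raw)]: "(\<lambda>w. f (b w) (a w)) \<in> borel_measurable W"
      if "a \<in> W \<rightarrow>\<^sub>M N" "b \<in> W \<rightarrow>\<^sub>M X" for a b and W :: "('a measure \<times> 'a) measure"
      using measurable_compose[OF measurable_Pair[OF that(2,1)] f] by simp
    have \<kappa> [measurable (raw)]: "(\<lambda>w. \<kappa> (b w) (a w)) \<in> borel_measurable W"
      if "a \<in> W \<rightarrow>\<^sub>M N" "b \<in> W \<rightarrow>\<^sub>M X" for a b and W :: "('a measure \<times> 'a) measure"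
      using measurable_compose[OF measurable_Pair[OF that(2,1)] assms(3)] by simp
    have "(\<lambda>\<mu>. \<integral>\<^sup>+x. f x \<mu> \<partial>\<mu>) \<in> borel_measurable N"
      by (intro measurable_nn_integral_counting) measurable
    then have "(\<integral>\<^sup>+\<mu>. \<integral>\<^sup>+x. f x \<mu> \<partial>\<mu> \<partial>?D) = (\<integral>\<^sup>+\<omega>. \<integral>\<^sup>+x. f x (\<eta> \<omega>) \<partial>\<eta> \<omega> \<partial>M)"
      by (intro nn_integral_distr) auto
    also have "\<dots> = (\<integral>\<^sup>+\<omega>. \<integral>\<^sup>+x. f x (add_point (\<eta> \<omega>) x) * ennreal (\<kappa> x (\<eta> \<omega>)) \<partial>\<Lambda> \<partial>M)"
      using assms(6) f unfolding gibbs_process_def by (auto dest!: spec[of _ "\<lambda>(x, \<mu>). f x \<mu>"])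
    also have "\<dots> = (\<integral>\<^sup>+\<mu>. \<integral>\<^sup>+x. f x (add_point \<mu> x) * ennreal (\<kappa> x \<mu>) \<partial>\<Lambda> \<partial>?D)"
      by (subst nn_integral_distr) measurable
    finally show "(\<integral>\<^sup>+\<mu>. \<integral>\<^sup>+x. f x \<mu> \<partial>\<mu> \<partial>?D) =
      (\<integral>\<^sup>+\<mu>. \<integral>\<^sup>+x. f x (add_point \<mu> x) * ennreal (\<kappa> x \<mu>) \<partial>\<Lambda> \<partial>?D)" .
  qed (use assms in auto)
  interpret Q: pair_sigma_finite "\<Pi>\<^sub>M i\<in>{1..m}. \<Lambda>" ?D
    using PL.sigma_finite[of "{1..m}"] D.sigma_finite_measure_axioms by (simp add: pair_sigma_finite_def)
  let ?P = "\<lambda>x \<mu>. kappa_iter X \<kappa> m x \<mu> = kappa_iter X \<kappa> m (\<lambda>i. x (\<tau> i)) \<mu>"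
  have [measurable]: "(\<lambda>w. kappa_iter X \<kappa> m (fst w) (snd w)) \<in> borel_measurable ((\<Pi>\<^sub>M i\<in>{1..m}. \<Lambda>) \<Otimes>\<^sub>M ?D)"
    "(\<lambda>w. kappa_iter X \<kappa> m (\<lambda>i. fst w (\<tau> i)) (snd w)) \<in> borel_measurable ((\<Pi>\<^sub>M i\<in>{1..m}. \<Lambda>) \<Otimes>\<^sub>M ?D)"
    using measurable_kappa_iter_permute[OF measurable_snd measurable_fst permutes_id]
      measurable_kappa_iter_permute[OF measurable_snd measurable_fst assms(7)] by auto
  have meas: "{w \<in> space ((\<Pi>\<^sub>M i\<in>{1..m}. \<Lambda>) \<Otimes>\<^sub>M ?D). ?P (fst w) (snd w)} \<in> sets ((\<Pi>\<^sub>M i\<in>{1..m}. \<Lambda>) \<Otimes>\<^sub>M ?D)"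
    by measurable
  have "AE \<mu> in ?D. AE x in \<Pi>\<^sub>M i\<in>{1..m}. \<Lambda>. ?P x \<mu>"
    using AE_invariant[of m] by eventually_elim (use assms(7) in \<open>simp add: invariant_def\<close>)
  then have "AE x in \<Pi>\<^sub>M i\<in>{1..m}. \<Lambda>. AE \<mu> in ?D. ?P x \<mu>"
    using Q.AE_commute[OF meas] by blast
  then show ?thesis
    using Q.AE_pair_iff[OF meas] by (simp add: case_prod_beta')
qed

end
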